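(* Let $n\ge 1$, $q=2^n$ and $c\in\mu_{q^2+1}\setminus\{1\}$. For $i\in\{0,1,2\}$ let $\omega_{c,i}$ denote the number of $b\in\mathbb{F}_{q^4}$ such that the equation $$(x+1)^{(q-1)(q^2+1)+2}+c^2x^{(q-1)(q^2+1)+2}=b^2$$ has exactly $i$ solutions $x\in\mathbb{F}_{q^4}$. Then $$\omega_{c,0}=\omega_{c,2}=\frac{q^4-q^2}{2},\qquad \omega_{c,1}=q^2.$$
   Context: $\mu_{q^2+1}=\{x\in\mathbb{F}_{q^4}^{*}: x^{q^2+1}=1\}$. *)

theory Defs
  imports Complex_Main "HOL-Library.Cardinality"
begin

definition unity_roots :: "nat \<Rightarrow> 'a::field set"
  where "unity_roots m = {x. x \<noteq> 0 \<and> x ^ m = 1}"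

(* The type 'a plays the role of the field with q^4 elements; the finite class makes both
   cardinalities genuine counts. *)
definition omega :: "nat \<Rightarrow> 'a::{field,finite} \<Rightarrow> nat \<Rightarrow> nat"
  where "omega q c i =
    card {b :: 'a. card {x :: 'a.
      (x + 1) ^ ((q - 1) * (q^2 + 1) + 2) + c^2 * x ^ ((q - 1) * (q^2 + 1) + 2) = b^2} = i}"

end

theory Submission
  imports Defs "HOL-Computational_Algebra.Polynomial"
begin

text \<open>
  Write \<open>f x = x^q\<close>, let \<open>k\<close> and \<open>K\<close> be the fixed fields of \<open>f\<close> and \<open>f\<^sup>2\<close>, \<open>N\<close> the norm to \<open>K\<close> and
  \<open>t = c + 1/c\<close>. For \<open>x \<noteq> 0\<close> one has \<open>x^d = (x v)\<^sup>2\<close> with \<open>v\<^sup>2 = N(x)^(q-1)\<close>, so \<open>v f(v) = 1\<close>, and after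
  taking square roots the equation becomes \<open>(x + 1) w + c x v = b\<close>, where \<open>w\<close> belongs to \<open>x + 1\<close>.
  Thus \<open>x = (b + w) / (w + c v)\<close> is determined by \<open>(v, w)\<close>. With \<open>b = \<beta> + \<gamma> c\<close> over \<open>K\<close> and
  \<open>h = v/w + w/v \<in> k\<close>, the conditions on \<open>(v, w)\<close> are \<open>\<psi>/w + f(\<psi>) w = P\<close> and
  \<open>\<psi>/v + f(\<psi>) v = R\<close>, with \<open>\<psi>, P, R\<close> depending only on \<open>b\<close> and \<open>h\<close>. For fixed \<open>h\<close> the solutions are a
  pair and its partner \<open>(s/v, s/w)\<close>, \<open>s = \<psi>/f(\<psi>)\<close>, and the two coincide exactly when \<open>\<beta>, \<gamma> \<in> k\<close>.

  It remains to see that \<open>b\<close> determines \<open>h\<close>. Eliminating \<open>v, w\<close> gives a quartic in \<open>h\<close> which is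
  divisible by \<open>(h + t) (h + f t)\<close>; by the remaining quadratic, two distinct values satisfy
  \<open>1/h + 1/h' = pr/(p + r)\<^sup>2 + (t + f t)/(t f(t))\<close> with \<open>p, r \<in> k\<close>. Here \<open>1/h\<close>, \<open>1/h'\<close> and the last summand
  have absolute trace 1 over \<open>k\<close> and \<open>pr/(p + r)\<^sup>2\<close> has trace 0, a contradiction. Hence every \<open>b\<close> has
  at most two solutions, and exactly one iff \<open>b \<in> k + k c\<close>.
\<close>

section \<open>Frobenius maps in characteristic two\<close>

text \<open>The intended instance is \<open>f x = x ^ q\<close> with \<open>rt\<close> the square
  root map. Working from these laws keeps exponents out of the algebra; \<open>ff_c\<close> encodes
  \<open>c ^ (q ^ 2 + 1) = 1\<close>.\<close>

locale frobenius_char2 =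
  fixes f rt :: "'a::field \<Rightarrow> 'a" and c :: 'a
  assumes char2: "(1::'a) + 1 = 0"
    and f_add [simp]: "f (x + y) = f x + f y"
    and f_mult [simp]: "f (x * y) = f x * f y"
    and f_one [simp]: "f 1 = 1"
    and f_four [simp]: "f (f (f (f x))) = x"
    and rt_sq: "rt x * rt x = x"
    and c_ne: "c \<noteq> 0" "c \<noteq> 1"
    and ff_c [simp]: "f (f c) = inverse c"
begin

lemma add_self [simp]: "x + x = (0::'a)"
proof -
  have "x + x = x * (1 + 1)" by (simp only: distrib_left mult_1_right)
  then show ?thesis by (simp only: char2 mult_zero_right)
qed

lemma two_eq_0 [simp]: "(2::'a) = 0"
  by (metis one_add_one char2)

lemma add_self_left [simp]: "x + (x + y) = (y::'a)"
  by (simp flip: add.assoc)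

lemma uminus_char2 [simp]: "- x = (x::'a)"
  by (metis add_self minus_unique)

lemma add_eq_0_char2: "x + y = 0 \<longleftrightarrow> x = (y::'a)"
  by (metis add_eq_0_iff uminus_char2)

lemma sum_sq: "(x + y) * (x + y) = x * x + y * (y::'a)"
  by (simp add: algebra_simps)

lemma quotient_sq_add: "s \<noteq> 0 \<Longrightarrow> (u / s) * (u / s) + u / s = u * (u + s) / (s * (s::'a))"
  by (simp add: field_simps)

lemma sq_inj: "x * x = y * y \<Longrightarrow> x = (y::'a)"
  by (metis sum_sq add_eq_0_char2 mult_eq_0_iff)

lemma f_zero [simp]: "f 0 = 0"
  by (metis add_self f_add)

lemma f_eq_0 [simp]: "f x = 0 \<longleftrightarrow> x = 0"
  by (metis f_four f_zero)

lemma f_inverse [simp]: "f (inverse x) = inverse (f x)"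
proof (cases "x = 0")
  case False
  then have "f (inverse x) * f x = 1" by (simp flip: f_mult)
  then show ?thesis by (metis inverse_unique mult.commute)
qed simp

lemma f_divide [simp]: "f (x / y) = f x / f y"
  by (simp add: divide_inverse)

lemma ff_c_ne: "f (f c) \<noteq> c"
proof
  assume "f (f c) = c"
  then have "c * c = 1 * 1" using c_ne by (simp add: field_simps)
  then show False using sq_inj c_ne by blast
qed

definition t :: 'a where "t = c + inverse c"

lemma ff_t [simp]: "f (f t) = t"
  by (simp add: t_def add.commute)

text \<open>\<open>f t = t\<close> would make \<open>f c\<close> a root of
  \<open>X * X + t * X + 1\<close>, hence \<open>c\<close> or \<open>1/c\<close>; either way
  \<open>f (f c) = c\<close>.\<close>

lemma f_t_ne: "f t \<noteq> t"
proof
  assume "f t = t"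
  have "(f c + c) * (c * f c + 1) = c * f c * (f t + t)"
    using c_ne by (simp add: t_def field_simps)
  then have "(f c + c) * (c * f c + 1) = 0"
    using \<open>f t = t\<close> by simp
  then consider "f c = c" | "c * f c = 1"
    by (metis mult_eq_0_iff add_eq_0_char2)
  then show False
  proof cases
    case 1
    then show ?thesis using ff_c_ne by simp
  next
    case 2
    then have "f c = inverse c" by (metis inverse_unique)
    then have "f (f c) = c" by (metis f_inverse inverse_inverse_eq)
    then show ?thesis using ff_c_ne by simp
  qed
qed

lemma t_ne_0: "t \<noteq> 0"
  using f_t_ne by auto

lemma add_t_ne_0: "f h = h \<Longrightarrow> h + t \<noteq> 0" "f h = h \<Longrightarrow> h + f t \<noteq> 0"
  using f_t_ne ff_t by (metis add_eq_0_char2)+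

section \<open>Elements of trace zero and one\<close>

text \<open>When \<open>f\<close> is the Frobenius map of a subfield \<open>k\<close> with \<open>q\<close> elements, \<open>T0\<close> and \<open>T1\<close>
  are the elements of \<open>k\<close> whose absolute trace is 0 and 1, respectively.\<close>

definition T0 :: "'a \<Rightarrow> bool" where "T0 y \<longleftrightarrow> (\<exists>m. f m = m \<and> y = m * m + m)"
definition T1 :: "'a \<Rightarrow> bool" where "T1 y \<longleftrightarrow> (\<exists>m. m + f m = 1 \<and> y = m * m + m)"

text \<open>Two roots of \<open>X * X + X = y\<close> differ by 0 or 1, so either all roots are
  fixed by \<open>f\<close> or none is.\<close>

lemma T1_not_T0: "T1 y \<Longrightarrow> \<not> T0 y"
proof
  assume "T1 y" "T0 y"
  then obtain m m' where m: "m + f m = 1" "y = m * m + m" "f m' = m'" "y = m' * m' + m'"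
    by (auto simp: T0_def T1_def)
  have "(m + m') * (m + m' + 1) = (m * m + m) + (m' * m' + m')"
    by (simp add: algebra_simps)
  also have "\<dots> = 0" using m by simp
  finally have "m = m' \<or> m = m' + 1"
    by (metis mult_eq_0_iff add_eq_0_char2 add.assoc)
  then have "f m = m" using m(3) by auto
  then show False using m(1) by simp
qed

lemma T1_add_T1:
  assumes "T1 x" "T1 y" shows "T0 (x + y)"
proof -
  obtain m m' where m: "m + f m = 1" "x = m * m + m" "m' + f m' = 1" "y = m' * m' + m'"
    using assms by (auto simp: T1_def)
  have "(f m + f m') + (m + m') = (m + f m) + (m' + f m')" by (simp only: ac_simps)
  also have "\<dots> = 0" using m by simp
  finally have "f (m + m') = m + m'" by (simp add: add_eq_0_char2)
  moreover have "x + y = (m + m') * (m + m') + (m + m')"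
    by (simp add: m sum_sq ac_simps)
  ultimately show ?thesis unfolding T0_def by blast
qed

lemma T1_add_T0:
  assumes "T1 x" "T0 y" shows "T1 (x + y)"
proof -
  obtain m m' where m: "m + f m = 1" "x = m * m + m" "f m' = m'" "y = m' * m' + m'"
    using assms by (auto simp: T0_def T1_def)
  have "(m + m') + f (m + m') = 1" using m by (simp add: ac_simps)
  moreover have "x + y = (m + m') * (m + m') + (m + m')"
    by (simp add: m sum_sq ac_simps)
  ultimately show ?thesis unfolding T1_def by blast
qed

text \<open>Since \<open>t = (1 + c)^2 / c\<close>, the element \<open>M = 1/(1 + c)\<close>
  satisfies \<open>M * M + M = 1/t\<close> and \<open>M + f (f M) = 1\<close>. The claim concerns
  \<open>1/t + f (1/t)\<close>, with witness \<open>M + f M\<close>.\<close>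

lemma T1_t: "T1 ((t + f t) / (t * f t))"
proof -
  define M where "M = inverse (1 + c)"
  have nz: "1 + c \<noteq> 0" using c_ne by (metis add_eq_0_char2)
  have ffM: "M + f (f M) = 1"
  proof -
    have "f (f M) = inverse (1 + inverse c)" by (simp add: M_def)
    also have "\<dots> = c * M" using nz c_ne by (simp add: M_def field_simps)
    also have "M + c * M = (1 + c) * M" by (simp add: distrib_right)
    finally show ?thesis using nz by (simp add: M_def)
  qed
  have t: "t = (1 + c) * (1 + c) / c" using c_ne by (simp add: t_def field_simps)
  have M2: "M * M + M = inverse t"
    using nz c_ne quotient_sq_add[of "1 + c" 1] unfolding t M_def by (simp add: inverse_eq_divide)
  have "(t + f t) / (t * f t) = inverse t + f (inverse t)"
    using t_ne_0 by (simp add: field_simps)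
  also have "\<dots> = (M + f M) * (M + f M) + (M + f M)"
    unfolding M2[symmetric] by (simp add: sum_sq ac_simps)
  finally have "(t + f t) / (t * f t) = (M + f M) * (M + f M) + (M + f M)" .
  moreover have "(M + f M) + f (M + f M) = 1"
    using ffM by (simp add: ac_simps)
  ultimately show ?thesis unfolding T1_def by blast
qed

lemma T0_ratio:
  assumes "f u = u" "f w = w" "u \<noteq> w"
  shows "T0 (u * w / ((u + w) * (u + w)))"
proof -
  have "u + w \<noteq> 0" using assms by (simp add: add_eq_0_char2)
  then have "u * w / ((u + w) * (u + w)) = (u / (u + w)) * (u / (u + w)) + u / (u + w)"
    using quotient_sq_add[of "u + w" u] by simp
  moreover have "f (u / (u + w)) = u / (u + w)" using assms by simp
  ultimately show ?thesis unfolding T0_def by blast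
qed

text \<open>The analogue of \<open>T0_ratio\<close> for a conjugate pair: \<open>f\<close> exchanges
  \<open>z\<close> and \<open>f z\<close>, so \<open>z / (z + f z)\<close> and its image add up to
  1.\<close>

lemma T1_norm_over_trace_sq:
  assumes "f (f z) = z" "z + f z \<noteq> 0"
  shows "T1 (z * f z / ((z + f z) * (z + f z)))"
proof -
  let ?m = "z / (z + f z)"
  have "?m + f ?m = 1" using assms by (simp add: add.commute flip: add_divide_distrib)
  moreover have "z * f z / ((z + f z) * (z + f z)) = ?m * ?m + ?m"
    using quotient_sq_add[OF assms(2), of z] by simp
  ultimately show ?thesis unfolding T1_def by blast
qed

section \<open>Norm-one elements and the ratio of a pair\<close>

definition mu :: "'a set" where "mu = {v. v * f v = 1}"

lemma mu_ne_0: "v \<in> mu \<Longrightarrow> v \<noteq> 0"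
  by (auto simp: mu_def)

lemma mu_f: "v \<in> mu \<Longrightarrow> f v = inverse v"
  by (auto simp: mu_def intro: inverse_unique[symmetric])

lemma mu_ff [simp]: "v \<in> mu \<Longrightarrow> f (f v) = v"
  using mu_f f_inverse inverse_inverse_eq by metis

text \<open>On \<open>mu\<close> this is \<open>v/w + w/v\<close>, the trace of \<open>v/w\<close>
  from \<open>K\<close> to \<open>k\<close>.\<close>

definition ratio :: "'a \<Rightarrow> 'a \<Rightarrow> 'a" where "ratio v w = v * f w + w * f v"

lemma f_ratio: "v \<in> mu \<Longrightarrow> w \<in> mu \<Longrightarrow> f (ratio v w) = ratio v w"
  by (simp add: ratio_def ac_simps)

lemma ratio_eq: "v \<in> mu \<Longrightarrow> w \<in> mu \<Longrightarrow> ratio v w = (v + w) * (v + w) / (v * w)"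
  using mu_ne_0[of v] mu_ne_0[of w] by (simp add: ratio_def mu_f field_simps)

lemma ratio_eq_0: "v \<in> mu \<Longrightarrow> w \<in> mu \<Longrightarrow> ratio v w = 0 \<longleftrightarrow> v = w"
  using mu_ne_0[of v] mu_ne_0[of w] by (simp add: ratio_eq add_eq_0_char2)

text \<open>As \<open>f\<close> inverts \<open>v\<close> and \<open>w\<close>, it exchanges
  \<open>w/(v + w)\<close> and \<open>v/(v + w)\<close>, whose sum is 1.\<close>

lemma T1_ratio:
  assumes "v \<in> mu" "w \<in> mu" "v \<noteq> w"
  shows "T1 (inverse (ratio v w))"
proof -
  have nz: "v \<noteq> 0" "w \<noteq> 0" "v + w \<noteq> 0" using assms mu_ne_0 by (auto simp: add_eq_0_char2)
  let ?m = "w / (v + w)"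
  have "f ?m = v / (v + w)"
  proof -
    have "f ?m = inverse w / ((v + w) / (v * w))" using nz assms(1,2) by (simp add: mu_f field_simps)
    then show ?thesis using nz by simp
  qed
  then have "?m + f ?m = 1" using nz(3) by (simp add: add.commute flip: add_divide_distrib)
  moreover have "inverse (ratio v w) = ?m * ?m + ?m"
    using quotient_sq_add[OF nz(3), of w] by (simp add: ratio_eq[OF assms(1,2)] add.commute[of w] ac_simps)
  ultimately show ?thesis unfolding T1_def by blast
qed

text \<open>\<open>cnorm \<beta> \<gamma>\<close> is the norm of \<open>\<beta> + \<gamma> c\<close>; \<open>lead\<close> and \<open>rhs\<close> are \<open>\<psi>\<close> and \<open>P\<close> (or \<open>R\<close>) above, and \<open>1/v\<close>
  is written \<open>f v\<close> for \<open>v \<in> mu\<close>.\<close>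

definition cnorm :: "'a \<Rightarrow> 'a \<Rightarrow> 'a" where "cnorm be ga = be * be + ga * ga + t * (be * ga)"
definition lead :: "'a \<Rightarrow> 'a \<Rightarrow> 'a" where "lead n h = n * (h + f t) + (h + t)"
definition rhs :: "'a \<Rightarrow> 'a \<Rightarrow> 'a" where "rhs h y = t * y * (h + f t) + f t * f y * (h + t)"

definition unit_pairs :: "'a \<Rightarrow> 'a \<Rightarrow> ('a \<times> 'a) set" where
  "unit_pairs be ga = {(v, w). v \<in> mu \<and> w \<in> mu \<and>
     lead (cnorm be ga) (ratio v w) * f w + f (lead (cnorm be ga) (ratio v w)) * w = rhs (ratio v w) ga \<and>
     lead (cnorm be ga) (ratio v w) * f v + f (lead (cnorm be ga) (ratio v w)) * v = rhs (ratio v w) be}"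

text \<open>With \<open>S = z * z / (v * w) + z' * z' * (v * w)\<close>, one has
  \<open>P * R = h * z * z' + S\<close> and \<open>P * P + R * R = h * S\<close>; eliminating
  \<open>S\<close> gives the identity.\<close>

lemma resultant_identity:
  fixes v :: 'a
  assumes "v \<noteq> 0" "w \<noteq> 0" "h = v / w + w / v" "P = z / w + z' * w" "R = z / v + z' * v"
  shows "h * h * (z * z') + h * (P * R) + P * P + R * R = 0"
  using assms(1,2) unfolding assms(3-) by (simp add: field_simps)

text \<open>The left-hand side comes from \<open>resultant_identity\<close>; the linear factors on the right never vanish
  for \<open>h \<in> k\<close>, since \<open>t \<notin> k\<close>.\<close>

lemma factor_identity:
  fixes be :: 'a
  assumes n: "n = be * be + ga * ga + s * (be * ga)"
    and n': "n' = be' * be' + ga' * ga' + s' * (be' * ga')"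
    and z: "z = n * (h + s') + (h + s)" and z': "z' = n' * (h + s) + (h + s')"
    and P: "P = s * ga * (h + s') + s' * ga' * (h + s)"
    and R: "R = s * be * (h + s') + s' * be' * (h + s)"
    and p: "p = be + be'" and r: "r = ga + ga'"
  shows "h * h * (z * z') + h * (P * R) + P * P + R * R =
     (h + s) * (h + s') * ((n + 1) * (n' + 1) * (h * h)
        + (s * s' * (p * r) + (s + s') * ((p + r) * (p + r))) * h + s * s' * ((p + r) * (p + r)))"
  unfolding z z' P R p r unfolding n n' by (simp add: algebra_simps)

lemma unit_pairs_quadratic:
  assumes K: "f (f be) = be" "f (f ga) = ga" and G: "(v, w) \<in> unit_pairs be ga"
  defines "h \<equiv> ratio v w" and "n \<equiv> cnorm be ga" and "p \<equiv> be + f be" and "r \<equiv> ga + f ga"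
  shows "(n + 1) * f (n + 1) * (h * h)
        + (t * f t * (p * r) + (t + f t) * ((p + r) * (p + r))) * h + t * f t * ((p + r) * (p + r)) = 0"
    (is "?Q = 0")
proof -
  have mu: "v \<in> mu" "w \<in> mu" using G by (auto simp: unit_pairs_def)
  have fh: "f h = h" unfolding h_def by (rule f_ratio[OF mu])
  have "h * h * (lead n h * f (lead n h)) + h * (rhs h ga * rhs h be) + rhs h ga * rhs h ga + rhs h be * rhs h be = 0"
    by (rule resultant_identity[of v w])
      (use G mu in \<open>auto simp: mu_ne_0 mu_f h_def n_def ratio_def unit_pairs_def divide_inverse\<close>)
  also have "h * h * (lead n h * f (lead n h)) + h * (rhs h ga * rhs h be) + rhs h ga * rhs h ga + rhs h be * rhs h be
     = (h + t) * (h + f t) * ?Q"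
    unfolding f_add f_one
    by (rule factor_identity) (simp_all add: n_def cnorm_def lead_def rhs_def fh K p_def r_def)
  finally show ?thesis using add_t_ne_0[OF fh] by simp
qed

section \<open>Uniqueness of the ratio\<close>

text \<open>1 and \<open>t\<close> are linearly independent over \<open>k\<close>: apply
  \<open>f\<close> and use \<open>f t \<noteq> t\<close>.\<close>

lemma t_independent:
  assumes "f x = x" "f y = y" "x = t * y"
  shows "x = 0" "y = 0"
proof -
  have "t * y = f t * y" using assms by (metis f_mult)
  then show "y = 0" using f_t_ne by auto
  then show "x = 0" using assms by simp
qed

text \<open>Excludes the degenerate case in which the equations on \<open>v\<close> and
  \<open>w\<close> become empty. A zero of \<open>lead\<close> would write
  \<open>(t + f t) / (t * f t)\<close>, of trace 1, as \<open>x * y / (x + y)^2\<close>, of trace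
  0.\<close>

lemma lead_ne_0:
  assumes K: "f (f be) = be" "f (f ga) = ga" and h: "f h = h" and rhs: "rhs h be = 0" "rhs h ga = 0"
  shows "lead (cnorm be ga) h \<noteq> 0"
proof
  assume lead: "lead (cnorm be ga) h = 0"
  note nz = add_t_ne_0[OF h]
  define x where "x = t * be / (h + t)"
  define y where "y = t * ga / (h + t)"
  define H where "H = (h + t) * (h + f t)"
  have fixed: "f (t * z / (h + t)) = t * z / (h + t)" if "f (f z) = z" "rhs h z = 0" for z
  proof -
    have "t * z * (h + f t) = f t * f z * (h + t)"
      using that by (simp add: rhs_def add_eq_0_char2)
    then show ?thesis using nz h by (simp add: frac_eq_eq)
  qed
  have fx: "f x = x" and fy: "f y = y" using fixed K rhs by (auto simp: x_def y_def)
  have fH: "f H = H" by (simp add: H_def h mult.commute)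
  have xy: "t * be = (h + t) * x" "t * ga = (h + t) * y" using nz by (simp_all add: x_def y_def)
  \<comment> \<open>The factor \<open>t * t\<close> lets \<open>t * be\<close> and
    \<open>t * ga\<close> be replaced by multiples of \<open>x\<close> and \<open>y\<close> in
    \<open>k\<close>.\<close>
  have "(h + t) * (t * t) = (t * t) * (cnorm be ga * (h + f t))"
    using lead by (simp add: lead_def add_eq_0_char2)
  also have "\<dots> = ((t * be) * (t * be) + (t * ga) * (t * ga) + t * ((t * be) * (t * ga))) * (h + f t)"
    by (simp add: cnorm_def algebra_simps)
  also have "\<dots> = (h + t) * (H * ((x + y) * (x + y) + t * (x * y)))"
    unfolding xy by (simp add: H_def algebra_simps)
  finally have tt: "t * t = H * ((x + y) * (x + y) + t * (x * y))" using nz by simp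
  \<comment> \<open>By \<open>t * t = t * (t + f t) + t * f t\<close>, the relation can be split
    into its coordinates with respect to 1 and \<open>t\<close>.\<close>
  have "H * ((x + y) * (x + y)) + t * f t = t * t + H * (t * (x * y)) + t * f t"
    unfolding tt by (simp add: algebra_simps)
  also have "\<dots> = t * (t + f t + H * (x * y))" by (simp add: algebra_simps)
  finally have eq: "H * ((x + y) * (x + y)) + t * f t = t * (t + f t + H * (x * y))" .
  have "f (H * ((x + y) * (x + y)) + t * f t) = H * ((x + y) * (x + y)) + t * f t"
    "f (t + f t + H * (x * y)) = t + f t + H * (x * y)"
    by (simp_all add: fH fx fy mult.commute add.commute add.left_commute)
  from t_independent[OF this eq] have nu: "t * f t = H * ((x + y) * (x + y))" and tau: "t + f t = H * (x * y)"
    by (simp_all add: add_eq_0_char2)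
  have "H * ((x + y) * (x + y)) \<noteq> 0" unfolding nu[symmetric] using t_ne_0 by simp
  then have "H \<noteq> 0" "x \<noteq> y" by auto
  then have "(t + f t) / (t * f t) = x * y / ((x + y) * (x + y))"
    unfolding nu tau by simp
  then show False using T0_ratio[OF fx fy \<open>x \<noteq> y\<close>] T1_t T1_not_T0 by simp
qed

text \<open>Compare coordinates with respect to 1 and \<open>t\<close>. The two pairs encode the
  exceptional values \<open>b = 1\<close> and \<open>b = c\<close>.\<close>

lemma cnorm_eq_1:
  assumes "f be = be" "f ga = ga" "cnorm be ga = 1"
  shows "(be, ga) = (1, 0) \<or> (be, ga) = (0, 1)"
proof -
  have "(be + ga + 1) * (be + ga + 1) = cnorm be ga + t * (be * ga) + 1"
    by (simp add: cnorm_def algebra_simps)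
  also have "\<dots> = t * (be * ga)" using assms by (simp add: ac_simps)
  finally have eq: "(be + ga + 1) * (be + ga + 1) = t * (be * ga)" .
  have "(be + ga + 1) * (be + ga + 1) = 0" "be * ga = 0"
    by (rule t_independent[OF _ _ eq]; simp add: assms)+
  then have "be + (ga + 1) = 0" "be = 0 \<or> ga = 0" by (auto simp: add.assoc)
  then show ?thesis by (auto simp: add_eq_0_char2)
qed

text \<open>Vieta for the reversed polynomial; the combination in the proof cancels
  \<open>a\<close>, so \<open>a = 0\<close> needs no separate case.\<close>

lemma quadratic_root_sum:
  fixes x :: 'a
  assumes "a * (x * x) + e * x + d = 0" "a * (y * y) + e * y + d = 0"
    "x \<noteq> 0" "y \<noteq> 0" "x \<noteq> y" "d \<noteq> 0"
  shows "inverse x + inverse y = e / d"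
proof -
  have "(x + y) * (d * (x + y) + e * (x * y))
    = (y * y) * (a * (x * x) + e * x + d) + (x * x) * (a * (y * y) + e * y + d)"
    by (simp add: algebra_simps)
  also have "\<dots> = 0" using assms by simp
  finally have "d * (x + y) = e * (x * y)"
    using assms(5) by (auto simp: add_eq_0_char2)
  moreover have "inverse x + inverse y = (x + y) / (x * y)"
    using assms by (simp add: field_simps)
  ultimately show ?thesis using assms by (simp add: frac_eq_eq mult.commute)
qed

text \<open>Divided by \<open>(s * s' * p)^2\<close>, the right-hand side is
  \<open>(s + s') / (s * s') + m * m + m\<close> with
  \<open>m = (s + s') * k / (s * s' * p)\<close>.\<close>

lemma degenerate_identity:
  fixes k :: 'a
  assumes n: "n = be * be + ga * ga + s * (be * ga)"
    and n': "n' = be' * be' + ga' * ga' + s' * (be' * ga')"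
    and b: "be = ga + k" "be' = ga' + k" and p: "p = ga + ga'"
  shows "(n * s' + s) * (n' * s + s') + (n + 1) * (n' + 1) * (s * s')
    = (s + s') * (s + s') * (k * k) + (s + s') * k * (s * s' * p) + (s + s') * (s * s' * (p * p))"
  unfolding p n n' b by (simp add: algebra_simps)

context
  fixes be ga :: 'a
  assumes K: "f (f be) = be" "f (f ga) = ga"
    and nontriv: "(be, ga) \<noteq> (1, 0)" "(be, ga) \<noteq> (0, 1)"
begin

lemma ratio_unique_nonzero:
  assumes G: "(v, w) \<in> unit_pairs be ga" "(v', w') \<in> unit_pairs be ga" and nz: "ratio v w \<noteq> 0" "ratio v' w' \<noteq> 0"
  shows "ratio v w = ratio v' w'"
proof (rule ccontr)
  assume ne: "ratio v w \<noteq> ratio v' w'"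
  define p where "p = be + f be"
  define r where "r = ga + f ga"
  define a where "a = (cnorm be ga + 1) * f (cnorm be ga + 1)"
  define d where "d = t * f t * ((p + r) * (p + r))"
  define e where "e = t * f t * (p * r) + (t + f t) * ((p + r) * (p + r))"
  have fp: "f p = p" "f r = r" using K by (simp_all add: p_def r_def add.commute)
  have mu: "v \<in> mu" "w \<in> mu" "v' \<in> mu" "w' \<in> mu" using G by (auto simp: unit_pairs_def)
  have Q1: "a * (ratio v w * ratio v w) + e * ratio v w + d = 0"
    using unit_pairs_quadratic[OF K G(1)] by (simp add: a_def d_def e_def p_def r_def)
  have Q2: "a * (ratio v' w' * ratio v' w') + e * ratio v' w' + d = 0"
    using unit_pairs_quadratic[OF K G(2)] by (simp add: a_def d_def e_def p_def r_def)
  show False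
  proof (cases "p = r")
    case False
    then have s: "p + r \<noteq> 0" by (simp add: add_eq_0_char2)
    then have d: "d \<noteq> 0" using t_ne_0 by (simp add: d_def)
    have "T1 (inverse (ratio v w))" "T1 (inverse (ratio v' w'))"
      using T1_ratio mu nz ratio_eq_0 by metis+
    then have "T0 (e / d)"
      using T1_add_T1 quadratic_root_sum[OF Q1 Q2 nz ne d] by metis
    moreover have "e / d = (t + f t) / (t * f t) + p * r / ((p + r) * (p + r))"
    proof -
      have "x * c1 + y * d1 = (y / x + c1 / d1) * (x * d1)" if "x \<noteq> 0" "d1 \<noteq> 0" for x y c1 d1 :: 'a
        using that by (simp add: field_simps)
      from this[of "t * f t" "(p + r) * (p + r)" "p * r" "t + f t"]
      show ?thesis using s t_ne_0 d by (simp add: e_def d_def)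
    qed
    moreover have "T1 \<dots>"
      by (rule T1_add_T0[OF T1_t T0_ratio[OF fp False]])
    ultimately show False using T1_not_T0 by simp
  next
    case True
    \<comment> \<open>The quadratic collapses to \<open>a * h = e\<close>; two distinct solutions
      force \<open>a = e = 0\<close>, which leaves only the excluded pairs.\<close>
    then have d: "d = 0" by (simp add: d_def)
    have "a * ratio v w = e" "a * ratio v' w' = e"
      using Q1 Q2 nz d by (auto simp: add_eq_0_char2 simp flip: mult.assoc)
    then have "a = 0" "e = 0" using ne by auto
    then have "p = 0" using True t_ne_0 by (auto simp: e_def)
    then have "f be = be" "f ga = ga" using True by (auto simp: p_def r_def add_eq_0_char2)
    moreover have "cnorm be ga = 1"
      using \<open>a = 0\<close> by (auto simp: a_def add_eq_0_char2 simp flip: f_add simp del: f_add)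
    ultimately show False using cnorm_eq_1 nontriv by blast
  qed
qed

text \<open>When \<open>h = 0\<close> there is no \<open>1/h\<close>; \<open>\<psi> f(\<psi>)/P\<^sup>2\<close>, which also has trace 1, takes its role.\<close>

lemma ratio_not_mixed:
  assumes G: "(v, w) \<in> unit_pairs be ga" "(v', w') \<in> unit_pairs be ga" and h: "ratio v w = 0" "ratio v' w' \<noteq> 0"
  shows False
proof -
  define n where "n = cnorm be ga"
  define p where "p = be + f be"
  define r where "r = ga + f ga"
  define k where "k = be + ga"
  have mu: "v \<in> mu" "w \<in> mu" "v' \<in> mu" "w' \<in> mu" using G by (auto simp: unit_pairs_def)
  \<comment> \<open>At \<open>h = 0\<close> only the constant term of the quadratic
    survives.\<close>
  have "(p + r) * (p + r) = 0"
    using unit_pairs_quadratic[OF K G(1)] h t_ne_0 by (simp add: p_def r_def)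
  then have pr: "p = r" by (simp add: add_eq_0_char2)
  have "n + 1 \<noteq> 0" if "p = 0"
  proof -
    have "f be = be" "f ga = ga" using that pr by (auto simp: p_def r_def add_eq_0_char2)
    then show ?thesis using cnorm_eq_1 nontriv by (metis add_eq_0_char2 n_def)
  qed
  moreover have a: "(n + 1) * f (n + 1) * ratio v' w' = t * f t * (p * p)"
    using unit_pairs_quadratic[OF K G(2)] h pr
    by (auto simp: add_eq_0_char2 n_def p_def[symmetric] r_def[symmetric] simp flip: mult.assoc distrib_right)
  ultimately have p0: "p \<noteq> 0" using h f_eq_0[of "n + 1"] by (auto simp del: f_add)
  have fp: "f p = p" using K by (simp add: p_def add.commute)
  have fk: "f k = k"
    using pr by (simp add: k_def p_def r_def) (metis add_eq_0_char2 add.assoc add.left_commute)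
  \<comment> \<open>For \<open>v = w\<close> the equation for \<open>be\<close> prescribes the trace
    \<open>z + f z\<close>, while \<open>z * f z\<close> is the norm of
    \<open>lead n 0\<close>.\<close>
  define z where "z = lead n 0 * f v"
  have ffn: "f (f n) = n" using K by (simp add: n_def cnorm_def)
  have zz: "z + f z = t * f t * p"
  proof -
    have "z + f z = rhs 0 be"
      using G(1) h mu by (auto simp: unit_pairs_def z_def n_def)
    then show ?thesis by (simp add: rhs_def p_def algebra_simps)
  qed
  have zN: "z * f z = lead n 0 * f (lead n 0)"
    using mu(1) by (simp add: z_def mu_def ac_simps)
  have "T1 (z * f z / ((t * f t * p) * (t * f t * p)))"
    unfolding zz[symmetric]
    by (rule T1_norm_over_trace_sq) (use zz p0 t_ne_0 ffn mu in \<open>auto simp: z_def lead_def\<close>)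
  moreover have "T1 (inverse (ratio v' w'))"
    using T1_ratio mu h ratio_eq_0 by metis
  moreover have "inverse (ratio v' w') = (n + 1) * f (n + 1) * (t * f t) / ((t * f t * p) * (t * f t * p))"
    using a p0 h t_ne_0 by (simp add: divide_simps)
  ultimately have "T0 ((z * f z + (n + 1) * f (n + 1) * (t * f t)) / ((t * f t * p) * (t * f t * p)))"
    using T1_add_T1 by (metis add_divide_distrib)
  moreover have "z * f z + (n + 1) * f (n + 1) * (t * f t)
     = (t + f t) * (t + f t) * (k * k) + (t + f t) * k * (t * f t * p) + (t + f t) * (t * f t * (p * p))"
  proof -
    have "(n * f t + t) * (f n * t + f t) + (n + 1) * (f n + 1) * (t * f t)
      = (t + f t) * (t + f t) * (k * k) + (t + f t) * k * (t * f t * p) + (t + f t) * (t * f t * (p * p))"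
    proof (rule degenerate_identity)
      show "be = ga + k" by (simp add: k_def add.commute[of be])
      then show "f be = f ga + k" using fk by (metis f_add)
      show "p = ga + f ga" using pr r_def by simp
    qed (simp_all add: n_def cnorm_def)
    then show ?thesis by (simp add: zN lead_def)
  qed
  moreover have "\<dots> / ((t * f t * p) * (t * f t * p))
     = (t + f t) / (t * f t) + (((t + f t) * k / (t * f t * p)) * ((t + f t) * k / (t * f t * p))
        + (t + f t) * k / (t * f t * p))"
  proof -
    have "(s * s * (k * k) + s * k * (x * p) + s * (x * (p * p))) / ((x * p) * (x * p))
      = s / x + ((s * k / (x * p)) * (s * k / (x * p)) + s * k / (x * p))" if "x \<noteq> 0" for x s :: 'a
      using p0 that by (simp add: field_simps)
    from this[of "t * f t" "t + f t"] show ?thesis using t_ne_0 by simp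
  qed
  moreover have "T1 \<dots>"
  proof (rule T1_add_T0[OF T1_t])
    have "f ((t + f t) * k / (t * f t * p)) = (t + f t) * k / (t * f t * p)"
      by (simp add: fk fp ac_simps)
    then show "T0 (((t + f t) * k / (t * f t * p)) * ((t + f t) * k / (t * f t * p))
        + (t + f t) * k / (t * f t * p))" unfolding T0_def by blast
  qed
  ultimately show False using T1_not_T0 by simp
qed

lemma ratio_unique:
  assumes "(v, w) \<in> unit_pairs be ga" "(v', w') \<in> unit_pairs be ga"
  shows "ratio v w = ratio v' w'"
  using ratio_unique_nonzero ratio_not_mixed assms by metis

end

section \<open>The partner of a unit pair\<close>

lemma mu_mult_f:
  assumes "s \<in> mu" "v \<in> mu"
  shows "s * f v \<in> mu"
proof -
  have "(s * f v) * f (s * f v) = (s * f s) * (v * f v)" by (simp only: f_mult mu_ff[OF assms(2)] ac_simps)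
  also have "\<dots> = 1" using assms by (simp add: mu_def)
  finally show ?thesis by (simp only: mu_def mem_Collect_eq)
qed

lemma rt_unique: "x * x = y \<Longrightarrow> rt y = x"
  using rt_sq sq_inj by metis

text \<open>Both are roots of one quadratic, whose roots have product
  \<open>p / f p\<close>.\<close>

lemma mu_quadratic_roots:
  assumes "v \<in> mu" "w \<in> mu" "p \<noteq> 0" "p * f v + f p * v = p * f w + f p * w"
  shows "w = v \<or> w = p / (f p * v)"
proof -
  note nz = mu_ne_0[OF assms(1)] mu_ne_0[OF assms(2)]
  have "p / v + f p * v = p / w + f p * w"
    using assms(4) by (simp add: mu_f assms(1,2) divide_inverse)
  moreover have "(v + w) * (p + f p * (v * w)) = v * w * ((p / v + f p * v) + (p / w + f p * w))"
    using nz by (simp add: field_simps)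
  ultimately have "(v + w) * (p + f p * (v * w)) = 0" by simp
  then have "v = w \<or> p = f p * (v * w)" by (simp add: add_eq_0_char2)
  then show ?thesis using nz assms(3) by (auto simp: field_simps)
qed

definition partner :: "'a \<Rightarrow> 'a \<Rightarrow> 'a \<times> 'a \<Rightarrow> 'a \<times> 'a" where
  "partner be ga = (\<lambda>(v, w). let p = lead (cnorm be ga) (ratio v w) in (p / (f p * v), p / (f p * w)))"

context
  fixes be ga :: 'a
  assumes K: "f (f be) = be" "f (f ga) = ga"
begin

lemma ff_cnorm: "f (f (cnorm be ga)) = cnorm be ga"
  using K by (simp add: cnorm_def)

lemma ff_lead: "f h = h \<Longrightarrow> f (f (lead (cnorm be ga) h)) = lead (cnorm be ga) h"
  using ff_cnorm by (simp add: lead_def)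

lemma unit_pairs_lead_ne_0:
  assumes "(v, w) \<in> unit_pairs be ga"
  shows "lead (cnorm be ga) (ratio v w) \<noteq> 0"
proof
  assume 0: "lead (cnorm be ga) (ratio v w) = 0"
  have "f (ratio v w) = ratio v w" using assms f_ratio by (auto simp: unit_pairs_def)
  then show False using assms lead_ne_0[OF K] 0 by (auto simp: unit_pairs_def)
qed

lemma lead_ratio_mu:
  assumes "f h = h" "lead (cnorm be ga) h \<noteq> 0"
  shows "lead (cnorm be ga) h / f (lead (cnorm be ga) h) \<in> mu"
  using assms ff_lead[OF assms(1)] by (simp add: mu_def del: f_add)

text \<open>On \<open>mu\<close> the partner is \<open>(s * f v, s * f w)\<close> with
  \<open>s * f s = 1\<close>, so \<open>s\<close> cancels in the ratio.\<close>

lemma partner_ratio: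
  assumes "(v, w) \<in> unit_pairs be ga" "partner be ga (v, w) = (v', w')"
  shows "v' \<in> mu" "w' \<in> mu" "ratio v' w' = ratio v w"
proof -
  define p where "p = lead (cnorm be ga) (ratio v w)"
  define s where "s = p / f p"
  have mu: "v \<in> mu" "w \<in> mu" using assms by (auto simp: unit_pairs_def)
  have s: "s \<in> mu" using lead_ratio_mu[OF f_ratio[OF mu]] unit_pairs_lead_ne_0[OF assms(1)] by (simp add: s_def p_def)
  have vw: "v' = s * f v" "w' = s * f w"
    using assms(2) mu by (auto simp: partner_def Let_def p_def s_def mu_f divide_inverse)
  show mu': "v' \<in> mu" "w' \<in> mu" unfolding vw using s mu by (simp_all only: mu_mult_f)
  have "ratio v' w' = (s * f s) * ratio v w" using mu by (simp add: ratio_def vw algebra_simps)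
  then show "ratio v' w' = ratio v w" using s by (simp add: mu_def)
qed

lemma partner_in_unit_pairs:
  assumes "(v, w) \<in> unit_pairs be ga"
  shows "partner be ga (v, w) \<in> unit_pairs be ga"
proof -
  obtain v' w' where vw': "partner be ga (v, w) = (v', w')" by fastforce
  define p where "p = lead (cnorm be ga) (ratio v w)"
  have mu: "v \<in> mu" "w \<in> mu" using assms by (auto simp: unit_pairs_def)
  note ph = partner_ratio[OF assms vw']
  have p: "p \<noteq> 0" using unit_pairs_lead_ne_0[OF assms] by (simp add: p_def)
  have ffp: "f (f p) = p" unfolding p_def by (rule ff_lead[OF f_ratio[OF mu]])
  have vw: "v' = p / (f p * v)" "w' = p / (f p * w)"
    using vw' by (auto simp: partner_def Let_def p_def)
  have "p * f v' + f p * v' = p * f v + f p * v" "p * f w' + f p * w' = p * f w + f p * w"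
    using p mu mu_ne_0[OF mu(1)] mu_ne_0[OF mu(2)] by (simp_all add: vw ffp mu_f field_simps)
  then show ?thesis using assms ph by (simp add: vw' unit_pairs_def p_def)
qed

text \<open>Each coordinate is one of two roots. In a mixed choice, equality of the ratios forces a
  double root in one coordinate, so the choice is the pair itself or its partner.\<close>

lemma unit_pairs_same_ratio:
  assumes G: "(v, w) \<in> unit_pairs be ga" "(v', w') \<in> unit_pairs be ga" and h: "ratio v' w' = ratio v w"
  shows "(v', w') = (v, w) \<or> (v', w') = partner be ga (v, w)"
proof -
  define p where "p = lead (cnorm be ga) (ratio v w)"
  define s where "s = p / f p"
  have mu: "v \<in> mu" "w \<in> mu" "v' \<in> mu" "w' \<in> mu" using G by (auto simp: unit_pairs_def)
  note nz = mu_ne_0[OF mu(1)] mu_ne_0[OF mu(2)] mu_ne_0[OF mu(3)] mu_ne_0[OF mu(4)]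
  have p: "p \<noteq> 0" using unit_pairs_lead_ne_0[OF G(1)] by (simp add: p_def)
  have s: "s \<noteq> 0" using p by (simp add: s_def)
  have "v' = v \<or> v' = p / (f p * v)"
    by (rule mu_quadratic_roots) (use G mu p h in \<open>auto simp: unit_pairs_def p_def\<close>)
  then have v': "v' = v \<or> v' = s / v" by (simp add: s_def)
  have "w' = w \<or> w' = p / (f p * w)"
    by (rule mu_quadratic_roots) (use G mu p h in \<open>auto simp: unit_pairs_def p_def\<close>)
  then have w': "w' = w \<or> w' = s / w" by (simp add: s_def)
  have part: "partner be ga (v, w) = (s / v, s / w)"
    by (simp add: partner_def Let_def s_def p_def)
  have "ratio v' w' * (v * w * (v' * w')) = ratio v w * (v * w * (v' * w'))" using h by simp
  then have "(v' * v' + w' * w') * (v * w) = (v * v + w * w) * (v' * w')"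
    unfolding ratio_eq[OF mu(1,2)] ratio_eq[OF mu(3,4)] using nz by (simp add: sum_sq)
  moreover have "(v' * v + w' * w) * (v' * w + w' * v)
      = (v' * v' + w' * w') * (v * w) + (v * v + w * w) * (v' * w')"
    by (simp add: algebra_simps)
  ultimately have "(v' * v + w' * w) * (v' * w + w' * v) = 0" by simp
  then consider "v' * v = w' * w" | "v' * w = w' * v" by (auto simp: add_eq_0_char2)
  then show ?thesis
  proof cases
    case 1
    have "s / v = v" if "v' = v" "w' = s / w" using 1 that nz by (simp add: divide_eq_eq)
    moreover have "s / w = w" if "v' = s / v" "w' = w" using 1 that nz by (simp add: divide_eq_eq)
    ultimately show ?thesis using v' w' unfolding part by auto
  next
    case 2
    have "s / w = w" if "v' = v" "w' = s / w"
    proof -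
      have "v * w = v * (s / w)" using 2 that by (simp add: mult.commute)
      then show ?thesis using nz(1) by (metis mult_left_cancel)
    qed
    moreover have "s / v = v" if "v' = s / v" "w' = w"
    proof -
      have "w * v = w * (s / v)" using 2 that by (simp add: mult.commute)
      then show ?thesis using nz(2) by (metis mult_left_cancel)
    qed
    ultimately show ?thesis using v' w' unfolding part by auto
  qed
qed

text \<open>A fixed pair has \<open>v * v = w * w = p / f p\<close>, so \<open>v = w\<close>,
  \<open>h = 0\<close> and both left-hand sides vanish; \<open>rhs 0 y = 0\<close> says
  \<open>f y = y\<close>.\<close>

lemma partner_fixed:
  assumes G: "(v, w) \<in> unit_pairs be ga" and fixed: "partner be ga (v, w) = (v, w)"
  shows "f be = be" "f ga = ga"
proof -
  define p where "p = lead (cnorm be ga) (ratio v w)"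
  have mu: "v \<in> mu" "w \<in> mu" using G by (auto simp: unit_pairs_def)
  note nz = mu_ne_0[OF mu(1)] mu_ne_0[OF mu(2)]
  have p: "p \<noteq> 0" using unit_pairs_lead_ne_0[OF G(1)] by (simp add: p_def)
  have sq: "p = f p * (v * v)" "p = f p * (w * w)"
    using fixed nz p by (auto simp: partner_def Let_def field_simps simp flip: p_def)
  then have "v = w" using sq_inj p by (metis mult_left_cancel f_eq_0)
  then have h: "ratio v w = 0" using ratio_eq_0 mu by blast
  have "p * f v + f p * v = 0" "p * f w + f p * w = 0"
    using sq nz by (simp_all add: mu_f mu add_eq_0_char2 field_simps)
  then have "rhs 0 be = 0" "rhs 0 ga = 0"
    using G by (auto simp: unit_pairs_def p_def simp flip: h)
  then show "f be = be" "f ga = ga" using t_ne_0 by (auto simp: rhs_def add_eq_0_char2)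
qed

lemma unit_pairs_nonempty:
  assumes "f be = be" "f ga = ga"
  shows "\<exists>v. (v, v) \<in> unit_pairs be ga"
proof -
  define p where "p = lead (cnorm be ga) 0"
  have rhs: "rhs 0 be = 0" "rhs 0 ga = 0" using assms by (simp_all add: rhs_def ac_simps)
  have p: "p \<noteq> 0" using lead_ne_0[OF K _ rhs] by (simp add: p_def)
  \<comment> \<open>The double root of the quadratic at \<open>h = 0\<close>, where both right-hand
    sides vanish.\<close>
  define v where "v = rt (p / f p)"
  have unit_part: "v * v = p / f p" by (simp add: v_def rt_sq)
  have ffp: "f (f p) = p" unfolding p_def by (rule ff_lead) simp
  have "(v * f v) * (v * f v) = (v * v) * f (v * v)" by (simp add: ac_simps)
  also have "\<dots> = 1 * 1" unfolding unit_part using p ffp by simp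
  finally have "v * f v = 1" by (rule sq_inj)
  then have mu: "v \<in> mu" by (simp add: mu_def)
  have h: "ratio v v = 0" by (simp add: ratio_def)
  have "p * f v + f p * v = f v * (p + f p * (v * v))"
    using mu by (simp add: mu_def algebra_simps)
  also have "\<dots> = 0" unfolding unit_part using p by simp
  finally have "(v, v) \<in> unit_pairs be ga"
    using mu rhs by (simp add: unit_pairs_def h p_def)
  then show ?thesis by blast
qed

lemma card_unit_pairs:
  assumes nontriv: "(be, ga) \<noteq> (1, 0)" "(be, ga) \<noteq> (0, 1)"
  shows "if f be = be \<and> f ga = ga then card (unit_pairs be ga) = 1 else card (unit_pairs be ga) = 0 \<or> card (unit_pairs be ga) = 2"
proof -
  \<comment> \<open>All pairs share one ratio, so any pair and its partner exhaust the set.\<close>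
  have eq: "unit_pairs be ga = {x, partner be ga x}" if "x \<in> unit_pairs be ga" for x
  proof -
    obtain v w where x: "x = (v, w)" by fastforce
    show ?thesis
    proof
      show "unit_pairs be ga \<subseteq> {x, partner be ga x}"
        using that unit_pairs_same_ratio ratio_unique[OF K nontriv] unfolding x by fast
      show "{x, partner be ga x} \<subseteq> unit_pairs be ga"
        using that partner_in_unit_pairs unfolding x by blast
    qed
  qed
  show ?thesis
  proof (cases "f be = be \<and> f ga = ga")
    case True
    then obtain v where v: "(v, v) \<in> unit_pairs be ga" using unit_pairs_nonempty by blast
    obtain v' w' where v': "partner be ga (v, v) = (v', w')" by fastforce
    have "v' = w'" using v' by (auto simp: partner_def Let_def)
    have mu: "v \<in> mu" using v by (auto simp: unit_pairs_def)
    have h: "ratio v v = 0" by (simp add: ratio_def)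
    define p where "p = lead (cnorm be ga) 0"
    have p: "p \<noteq> 0" using unit_pairs_lead_ne_0[OF v] by (simp add: p_def h)
    have "p * f v + f p * v = 0"
      using v True by (auto simp: unit_pairs_def p_def h rhs_def ac_simps)
    then have "p = f p * (v * v)"
      using mu_ne_0[OF mu] by (simp add: mu_f[OF mu] add_eq_0_char2 field_simps)
    then have "partner be ga (v, v) = (v, v)"
      using p mu_ne_0[OF mu] by (simp add: partner_def Let_def h field_simps flip: p_def)
    then show ?thesis using eq[OF v] True by simp
  next
    case False
    show ?thesis
    proof (cases "unit_pairs be ga = {}")
      case True
      then show ?thesis using False by simp
    next
      case ne: False
      then obtain v w where x: "(v, w) \<in> unit_pairs be ga" by auto
      have "partner be ga (v, w) \<noteq> (v, w)" using partner_fixed[OF x] False by blast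
      then show ?thesis using eq[OF x] False by simp
    qed
  qed
qed

end

section \<open>Solutions and unit pairs\<close>

definition relnorm :: "'a \<Rightarrow> 'a" where "relnorm x = x * f (f x)"
text \<open>The quotient is \<open>relnorm x ^ (q - 1)\<close> in the intended instance for nonzero
  \<open>x\<close>. Since 0/0 = 0, \<open>unit_part 0 = 0\<close>, so \<open>cdiff\<close> also
  covers \<open>x = 0\<close> and \<open>x = 1\<close>.\<close>

definition unit_part :: "'a \<Rightarrow> 'a" where "unit_part x = rt (f (relnorm x) / relnorm x)"
definition cdiff :: "'a \<Rightarrow> 'a" where "cdiff x = (x + 1) * unit_part (x + 1) + c * (x * unit_part x)"

definition Fix :: "'a set" where "Fix = {x. f x = x}"

lemma relnorm_mult: "relnorm (x * y) = relnorm x * relnorm y"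
  by (simp add: relnorm_def)

lemma relnorm_eq_0 [simp]: "relnorm x = 0 \<longleftrightarrow> x = 0"
  by (simp add: relnorm_def)

lemma ff_relnorm [simp]: "f (f (relnorm x)) = relnorm x"
  by (simp add: relnorm_def mult.commute)

lemma relnorm_divide: "relnorm (x / y) = relnorm x / relnorm y"
  by (simp add: relnorm_def)

lemma unit_part_0 [simp]: "unit_part 0 = 0"
  by (simp add: unit_part_def relnorm_def rt_unique[of 0 0, simplified])

lemma unit_part_1 [simp]: "unit_part 1 = 1"
  by (simp add: unit_part_def relnorm_def rt_unique[of 1 1, simplified])

lemma unit_part_mu: assumes "x \<noteq> 0" shows "unit_part x \<in> mu"
proof -
  have "(unit_part x * f (unit_part x)) * (unit_part x * f (unit_part x)) = (unit_part x * unit_part x) * f (unit_part x * unit_part x)"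
    by (simp add: ac_simps)
  also have "\<dots> = 1 * 1" using assms by (simp add: unit_part_def rt_sq)
  finally have "unit_part x * f (unit_part x) = 1" by (rule sq_inj)
  then show ?thesis by (simp add: mu_def)
qed

lemma relnorm_unit_part_Fix: assumes "x \<noteq> 0" shows "relnorm x * unit_part x \<in> Fix"
proof -
  have fN: "f (relnorm x) = relnorm x * (unit_part x * unit_part x)" using assms by (simp add: unit_part_def rt_sq)
  have "f (relnorm x * unit_part x) = f (relnorm x) * f (unit_part x)" by simp
  also have "\<dots> = relnorm x * unit_part x * (unit_part x * f (unit_part x))" unfolding fN by (simp only: ac_simps)
  also have "\<dots> = relnorm x * unit_part x" using unit_part_mu[OF assms] by (simp add: mu_def)
  finally show ?thesis by (simp only: Fix_def mem_Collect_eq)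
qed

text \<open>Converse of \<open>relnorm_unit_part_Fix\<close>: membership in \<open>k\<close>
  recognises the unit part without a square root.\<close>

lemma unit_part_eqI:
  assumes "x \<noteq> 0" "v \<in> mu" "relnorm x * v \<in> Fix"
  shows "unit_part x = v"
  unfolding unit_part_def
proof (rule rt_unique)
  have "f (relnorm x) / v = relnorm x * v" using assms by (simp add: Fix_def mu_f divide_inverse)
  then show "v * v = f (relnorm x) / relnorm x" using assms(1) mu_ne_0[OF assms(2)] by (simp add: field_simps)
qed

section \<open>Coordinates over \<open>K\<close> and norms of shifted elements\<close>

lemma ff_eq_c_multiple:
  assumes "f (f x) = x" "f (f y) = y" "x = c * y" shows "x = 0" "y = 0"
proof -
  have "c * y = f (f c) * y" using assms by (metis f_mult)
  then show "y = 0" using ff_c_ne by auto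
  then show "x = 0" using assms by simp
qed

lemma c_decomposition:
  "\<exists>be ga. f (f be) = be \<and> f (f ga) = ga \<and> b = be + ga * c"
proof -
  \<comment> \<open>Solves \<open>b = be + ga * c\<close> together with its conjugate
    \<open>f (f b) = be + ga / c\<close>.\<close>
  let ?be = "(b * inverse c + f (f b) * c) / t" and ?ga = "(b + f (f b)) / t"
  have "?be + ?ga * c = (b * inverse c + f (f b) * c + (b + f (f b)) * c) / t"
    by (simp add: add_divide_distrib distrib_right)
  also have "\<dots> = b * t / t" by (simp add: t_def algebra_simps)
  finally have "b = ?be + ?ga * c" using t_ne_0 by simp
  moreover have "f (f ?be) = ?be"
    by (simp add: add.commute)
  moreover have "f (f ?ga) = ?ga"
    by (simp add: add.commute)
  ultimately show ?thesis by blast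
qed

lemma denominator_ne_0:
  assumes "v \<in> mu" "w \<in> mu" shows "w + c * v \<noteq> 0"
  using ff_eq_c_multiple(2)[OF mu_ff[OF assms(2)] mu_ff[OF assms(1)]] mu_ne_0[OF assms(1)]
  unfolding add_eq_0_char2 by blast

lemma relnorm_denominator:
  assumes "v \<in> mu" "w \<in> mu" shows "relnorm (w + c * v) = v * w * (ratio v w + t)"
  using assms c_ne mu_ne_0[of v] mu_ne_0[of w]
  by (simp add: relnorm_def ratio_eq t_def field_simps)

text \<open>The origin of \<open>lead\<close> and \<open>rhs\<close>: they arise by clearing
  denominators in the statement that the quotient is fixed by \<open>f\<close>.\<close>

lemma rhs_iff:
  assumes "f h = h" "f (f y) = y" "f (f n) = n" "w \<in> mu"
  shows "lead n h * f w + f (lead n h) * w = rhs h y \<longleftrightarrow>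
    (n * f w + t * y + w) / (h + t) \<in> Fix"
proof -
  let ?x = "n * f w + t * y + w"
  have "lead n h * f w + f (lead n h) * w + rhs h y = ?x * (h + f t) + f ?x * (h + t)"
    using assms by (simp add: lead_def rhs_def algebra_simps)
  then have "lead n h * f w + f (lead n h) * w = rhs h y \<longleftrightarrow> f ?x * (h + t) = ?x * (h + f t)"
    by (metis add_eq_0_char2)
  also have "\<dots> \<longleftrightarrow> f ?x / (h + f t) = ?x / (h + t)"
    using add_t_ne_0[OF assms(1)] by (simp add: frac_eq_eq)
  also have "f ?x / (h + f t) = f (?x / (h + t))" using assms(1) by simp
  finally show ?thesis by (simp only: Fix_def mem_Collect_eq)
qed

text \<open>\<open>mu\<close> meets \<open>k\<close> only in 1. The quotient stays uncancelled to
  match the conditions in \<open>unit_pairs_iff\<close>.\<close>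

lemma mu_times_norm_fixed:
  assumes "v \<in> mu" "f h = h" "v * (h + t) / (h + t) \<in> Fix"
  shows "v = 1"
proof -
  have "f v = v" using assms(3) add_t_ne_0(1)[OF assms(2)] by (simp add: Fix_def)
  then have "v * v = 1 * 1" using assms(1) by (simp add: mu_def)
  then show ?thesis by (rule sq_inj)
qed

lemma sol_shift:
  assumes "cdiff x = be + ga * c" "v = unit_part x" "w = unit_part (x + 1)"
  shows "be + ga * c + w = x * (w + c * v)" "be + ga * c + c * v = (x + 1) * (w + c * v)"
  unfolding assms(1)[symmetric] assms(2,3) by (simp_all add: cdiff_def algebra_simps)

context
  fixes be ga :: 'a
  assumes K: "f (f be) = be" "f (f ga) = ga"
begin

lemma unit_pairs_iff:
  "(v, w) \<in> unit_pairs be ga \<longleftrightarrow> v \<in> mu \<and> w \<in> mu \<and>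
     (cnorm be ga * f w + t * ga + w) / (ratio v w + t) \<in> Fix \<and>
     (cnorm be ga * f v + t * be + v) / (ratio v w + t) \<in> Fix"
  using rhs_iff[OF f_ratio K(2) ff_cnorm[OF K]] rhs_iff[OF f_ratio K(1) ff_cnorm[OF K]]
  by (auto simp: unit_pairs_def)

lemma relnorm_shift:
  assumes "w \<in> mu"
  shows "relnorm (be + ga * c + w) = w * (cnorm be ga * f w + t * ga + w)"
    and "relnorm (be + ga * c + c * w) = w * (cnorm be ga * f w + t * be + w)"
proof -
  have w: "w * (n * f w + y + w) = n + w * y + w * w" for n y
    using assms by (simp add: mu_f mu_ne_0 field_simps)
  have c: "c * (x * inverse c) = x" "c * (x * (y * inverse c)) = x * y" for x y
    using c_ne by (simp_all add: field_simps)
  show "relnorm (be + ga * c + w) = w * (cnorm be ga * f w + t * ga + w)"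
    "relnorm (be + ga * c + c * w) = w * (cnorm be ga * f w + t * be + w)"
    unfolding w using assms K by (simp_all add: relnorm_def cnorm_def t_def algebra_simps c)
qed

text \<open>Take norms in \<open>b + w = x * (w + c * v)\<close> and
  \<open>b + c * v = (x + 1) * (w + c * v)\<close>.\<close>

lemma sol_relnorm:
  assumes "cdiff x = be + ga * c" "x \<noteq> 0" "x \<noteq> 1" "v = unit_part x" "w = unit_part (x + 1)"
  shows "(cnorm be ga * f w + t * ga + w) / (ratio v w + t) = relnorm x * v"
    and "(cnorm be ga * f v + t * be + v) / (ratio v w + t) = relnorm (x + 1) * w"
proof -
  have mu: "v \<in> mu" "w \<in> mu" using unit_part_mu assms by (auto simp: add_eq_0_char2)
  note nz = mu_ne_0[OF mu(1)] mu_ne_0[OF mu(2)] add_t_ne_0(1)[OF f_ratio[OF mu]]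
  have "w * (cnorm be ga * f w + t * ga + w) = relnorm x * (v * w * (ratio v w + t))"
    by (simp only: relnorm_shift(1)[OF mu(2), symmetric] sol_shift(1)[OF assms(1,4,5)] relnorm_mult relnorm_denominator[OF mu])
  then show "(cnorm be ga * f w + t * ga + w) / (ratio v w + t) = relnorm x * v"
    using nz by (simp add: divide_eq_eq)
  have "v * (cnorm be ga * f v + t * be + v) = relnorm (x + 1) * (v * w * (ratio v w + t))"
    by (simp only: relnorm_shift(2)[OF mu(1), symmetric] sol_shift(2)[OF assms(1,4,5)] relnorm_mult relnorm_denominator[OF mu])
  then show "(cnorm be ga * f v + t * be + v) / (ratio v w + t) = relnorm (x + 1) * w"
    using nz by (simp add: divide_eq_eq)
qed

lemma sol_in_unit_pairs:
  assumes "cdiff x = be + ga * c" "x \<noteq> 0" "x \<noteq> 1"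
  shows "(unit_part x, unit_part (x + 1)) \<in> unit_pairs be ga"
proof -
  have x1: "x + 1 \<noteq> 0" using assms by (simp add: add_eq_0_char2)
  note mu = unit_part_mu[OF assms(2)] unit_part_mu[OF x1]
  show ?thesis
    unfolding unit_pairs_iff sol_relnorm[OF assms refl refl] using mu relnorm_unit_part_Fix assms(2) x1 by blast
qed

text \<open>Ensures that the reconstructed \<open>x\<close> is neither 0 nor 1. Equality would
  determine \<open>be\<close> and \<open>ga\<close>, and the other fixedness condition would then
  give an excluded pair.\<close>

lemma unit_pairs_shift_ne_0:
  assumes G: "(v, w) \<in> unit_pairs be ga" and nontriv: "(be, ga) \<noteq> (1, 0)" "(be, ga) \<noteq> (0, 1)"
  shows "be + ga * c \<noteq> w" "be + ga * c \<noteq> c * v"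
proof -
  have mu: "v \<in> mu" "w \<in> mu" using G by (auto simp: unit_pairs_def)
  note nz = mu_ne_0[OF mu(1)] mu_ne_0[OF mu(2)]
  note h = f_ratio[OF mu]
  have fixed: "(cnorm be ga * f w + t * ga + w) / (ratio v w + t) \<in> Fix"
    "(cnorm be ga * f v + t * be + v) / (ratio v w + t) \<in> Fix"
    using G by (simp_all add: unit_pairs_iff)
  show "be + ga * c \<noteq> w"
  proof
    assume "be + ga * c = w"
    then have "be + w = c * ga"
      by (metis add.commute add_self_left mult.commute)
    from ff_eq_c_multiple[OF _ K(2) this] have "be + w = 0" "ga = 0" using K mu by simp_all
    then have b: "be = w" "ga = 0" by (auto simp: add_eq_0_char2)
    have "cnorm be ga * f v + t * be + v = w * (ratio v w + t)"
      unfolding b using nz by (simp add: cnorm_def ratio_def mu_f mu field_simps)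
    then have "w = 1" using mu_times_norm_fixed[OF mu(2) h] fixed(2) by simp
    then show False using b nontriv by simp
  qed
  show "be + ga * c \<noteq> c * v"
  proof
    assume "be + ga * c = c * v"
    then have "be = c * (ga + v)"
      by (metis add.commute add_self_left mult.commute distrib_left)
    from ff_eq_c_multiple[OF K(1) _ this] have "be = 0" "ga + v = 0" using K mu by simp_all
    then have b: "be = 0" "ga = v" by (auto simp: add_eq_0_char2)
    have "cnorm be ga * f w + t * ga + w = v * (ratio v w + t)"
      unfolding b using nz by (simp add: cnorm_def ratio_def mu_f mu field_simps)
    then have "v = 1" using mu_times_norm_fixed[OF mu(1) h] fixed(1) by simp
    then show False using b nontriv by simp
  qed
qed

lemma unit_pairs_sol:
  assumes G: "(v, w) \<in> unit_pairs be ga" and nontriv: "(be, ga) \<noteq> (1, 0)" "(be, ga) \<noteq> (0, 1)"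
  defines "x \<equiv> (be + ga * c + w) / (w + c * v)"
  shows "cdiff x = be + ga * c" "unit_part x = v" "unit_part (x + 1) = w"
proof -
  have mu: "v \<in> mu" "w \<in> mu" using G by (auto simp: unit_pairs_def)
  note h = f_ratio[OF mu]
  note D = denominator_ne_0[OF mu]
  note nz = mu_ne_0[OF mu(1)] mu_ne_0[OF mu(2)] add_t_ne_0(1)[OF h]
  have x1: "x + 1 = (be + ga * c + c * v) / (w + c * v)"
    using D by (simp add: x_def add_divide_eq_iff ac_simps)
  have ne: "x \<noteq> 0" "x + 1 \<noteq> 0"
    using unit_pairs_shift_ne_0[OF G nontriv] D unfolding x1 unfolding x_def by (simp_all add: add_eq_0_char2)
  have "relnorm x * v = (cnorm be ga * f w + t * ga + w) / (ratio v w + t)"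
    unfolding x_def relnorm_divide relnorm_shift[OF mu(2)] relnorm_denominator[OF mu] using nz by (simp add: frac_eq_eq)
  moreover have "relnorm (x + 1) * w = (cnorm be ga * f v + t * be + v) / (ratio v w + t)"
    unfolding x1 relnorm_divide relnorm_shift[OF mu(1)] relnorm_denominator[OF mu] using nz by (simp add: frac_eq_eq)
  ultimately have "relnorm x * v \<in> Fix" "relnorm (x + 1) * w \<in> Fix"
    using G by (simp_all add: unit_pairs_iff)
  then show v: "unit_part x = v" and w: "unit_part (x + 1) = w"
    using unit_part_eqI ne mu by blast+
  have "cdiff x = x * (w + c * v) + w"
    unfolding cdiff_def v w by (simp add: algebra_simps)
  then show "cdiff x = be + ga * c" using D by (simp add: x_def)
qed

lemma sol_bij_unit_pairs:
  assumes nontriv: "(be, ga) \<noteq> (1, 0)" "(be, ga) \<noteq> (0, 1)"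
  shows "bij_betw (\<lambda>x. (unit_part x, unit_part (x + 1))) {x. cdiff x = be + ga * c} (unit_pairs be ga)"
proof -
  \<comment> \<open>\<open>cdiff 0 = 1\<close> and \<open>cdiff 1 = c\<close>, so these two
    arguments occur only for the excluded pairs.\<close>
  have ne: "x \<noteq> 0" "x \<noteq> 1" if "cdiff x = be + ga * c" for x
  proof -
    have *: "f (f (be + y)) = be + y" "f (f (ga + y)) = ga + y" if "f (f y) = y" for y
      using K that by simp_all
    show "x \<noteq> 0"
    proof
      assume "x = 0"
      then have "be + 1 = c * ga" using that
        by (simp add: cdiff_def) (metis add.commute add_self_left mult.commute)
      from ff_eq_c_multiple[OF *(1) K(2) this] have "be + 1 = 0" "ga = 0" by simp_all
      then show False using nontriv by (simp add: add_eq_0_char2)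
    qed
    show "x \<noteq> 1"
    proof
      assume "x = 1"
      then have "be = c * (ga + 1)" using that
        by (simp add: cdiff_def distrib_left) (metis add.commute add_self_left mult.commute)
      from ff_eq_c_multiple[OF K(1) *(2) this] have "be = 0" "ga + 1 = 0" by simp_all
      then show False using nontriv by (simp add: add_eq_0_char2)
    qed
  qed
  show ?thesis
  proof (rule bij_betw_byWitness[where f' = "\<lambda>(v, w). (be + ga * c + w) / (w + c * v)"])
    show "\<forall>x\<in>{x. cdiff x = be + ga * c}.
       (case (unit_part x, unit_part (x + 1)) of (v, w) \<Rightarrow> (be + ga * c + w) / (w + c * v)) = x"
      using ne unit_part_mu denominator_ne_0 sol_shift(1)[OF _ refl refl] by (simp add: add_eq_0_char2)
    show "\<forall>y\<in>unit_pairs be ga. (unit_part (case y of (v, w) \<Rightarrow> (be + ga * c + w) / (w + c * v)),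
        unit_part ((case y of (v, w) \<Rightarrow> (be + ga * c + w) / (w + c * v)) + 1)) = y"
      using unit_pairs_sol nontriv by auto
    show "(\<lambda>x. (unit_part x, unit_part (x + 1))) ` {x. cdiff x = be + ga * c} \<subseteq> unit_pairs be ga"
      using sol_in_unit_pairs ne by blast
    show "(\<lambda>(v, w). (be + ga * c + w) / (w + c * v)) ` unit_pairs be ga \<subseteq> {x. cdiff x = be + ga * c}"
      using unit_pairs_sol nontriv by auto
  qed
qed

end

section \<open>The exceptional values 1 and \<open>c\<close>\<close>

lemma trace_multiple_eq_0:
  assumes "v \<in> mu" "f h = h" "(f v + v) / (h + t) \<in> Fix"
  shows "(f v + v) / (h + t) = 0"
proof -
  let ?L = "(f v + v) / (h + t)"
  have L: "f ?L = ?L" using assms(3) by (simp only: Fix_def mem_Collect_eq)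
  \<comment> \<open>Here \<open>?L\<close> and the left-hand side lie in \<open>k\<close>, so the
    independence of 1 and \<open>t\<close> gives \<open>?L = 0\<close>.\<close>
  have "?L * h + (f v + v) = t * ?L"
    using add_t_ne_0(1)[OF assms(2)] by (simp add: add_divide_eq_iff divide_simps algebra_simps)
  moreover have "f (?L * h + (f v + v)) = ?L * h + (f v + v)"
    unfolding f_add f_mult assms(2) L using assms(1) by (simp add: add.commute)
  ultimately show ?thesis using t_independent(2) L by blast
qed

text \<open>For another solution, \<open>relnorm x * unit_part x\<close> would be a nonzero element
  of \<open>k\<close> of the form excluded by \<open>trace_multiple_eq_0\<close>.\<close>

lemma sol_one: "{x. cdiff x = 1} = {0}"
proof -
  have "x = 0" if "cdiff x = 1" for x
  proof (rule ccontr)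
    assume x: "x \<noteq> 0"
    have "x \<noteq> 1" using that c_ne by (auto simp: cdiff_def)
    have x1: "x + 1 \<noteq> 0" using \<open>x \<noteq> 1\<close> by (simp add: add_eq_0_char2)
    note mu = unit_part_mu[OF x] unit_part_mu[OF x1]
    have L: "(f (unit_part (x + 1)) + unit_part (x + 1)) / (ratio (unit_part x) (unit_part (x + 1)) + t) = relnorm x * unit_part x"
      using sol_relnorm(1)[of 1 0 x] that x \<open>x \<noteq> 1\<close> by (simp add: cnorm_def)
    then have "relnorm x * unit_part x = 0"
      using trace_multiple_eq_0[OF mu(2) f_ratio[OF mu]] relnorm_unit_part_Fix[OF x] by simp
    then show False using x mu_ne_0[OF mu(1)] by simp
  qed
  then show ?thesis by (auto simp: cdiff_def)
qed

lemma sol_c: "{x. cdiff x = c} = {1}"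
proof -
  have "x = 1" if "cdiff x = c" for x
  proof (rule ccontr)
    assume "x \<noteq> 1"
    have x: "x \<noteq> 0" using that c_ne by (auto simp: cdiff_def)
    have x1: "x + 1 \<noteq> 0" using \<open>x \<noteq> 1\<close> by (simp add: add_eq_0_char2)
    note mu = unit_part_mu[OF x] unit_part_mu[OF x1]
    have L: "(f (unit_part x) + unit_part x) / (ratio (unit_part x) (unit_part (x + 1)) + t) = relnorm (x + 1) * unit_part (x + 1)"
      using sol_relnorm(2)[of 0 1 x] that x \<open>x \<noteq> 1\<close> by (simp add: cnorm_def)
    then have "relnorm (x + 1) * unit_part (x + 1) = 0"
      using trace_multiple_eq_0[OF mu(1) f_ratio[OF mu]] relnorm_unit_part_Fix[OF x1] by simp
    then show False using x1 mu_ne_0[OF mu(2)] by simp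
  qed
  then show ?thesis by (auto simp: cdiff_def)
qed

section \<open>Fibre sizes of \<open>cdiff\<close>\<close>

lemma card_fibre:
  assumes "f (f be) = be" "f (f ga) = ga"
  shows "if f be = be \<and> f ga = ga then card {x. cdiff x = be + ga * c} = 1
    else card {x. cdiff x = be + ga * c} \<in> {0, 2}"
proof (cases "(be, ga) = (1, 0) \<or> (be, ga) = (0, 1)")
  case True
  then show ?thesis using sol_one sol_c by auto
next
  case False
  then show ?thesis
    using card_unit_pairs[OF assms] bij_betw_same_card[OF sol_bij_unit_pairs[OF assms]] by simp
qed

lemma card_fibre_le_2: "card {x. cdiff x = b} \<in> {0, 1, 2}"
proof -
  obtain be ga where "f (f be) = be" "f (f ga) = ga" "b = be + ga * c"
    using c_decomposition by blast
  then show ?thesis using card_fibre[of be ga] by (auto split: if_splits)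
qed

lemma card_fibre_eq_1:
  "{b. card {x. cdiff x = b} = 1} = (\<lambda>(be, ga). be + ga * c) ` ({x. f x = x} \<times> {x. f x = x})"
proof (intro equalityI subsetI)
  fix b assume "b \<in> {b. card {x. cdiff x = b} = 1}"
  moreover obtain be ga where "f (f be) = be" "f (f ga) = ga" "b = be + ga * c"
    using c_decomposition by blast
  ultimately show "b \<in> (\<lambda>(be, ga). be + ga * c) ` ({x. f x = x} \<times> {x. f x = x})"
    using card_fibre[of be ga] by (auto split: if_splits)
next
  fix b assume "b \<in> (\<lambda>(be, ga). be + ga * c) ` ({x. f x = x} \<times> {x. f x = x})"
  then show "b \<in> {b. card {x. cdiff x = b} = 1}" using card_fibre by fastforce
qed

lemma inj_on_c_combination: "inj_on (\<lambda>(be, ga). be + ga * c) ({x. f x = x} \<times> {x. f x = x})"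
proof (rule inj_onI, clarsimp)
  fix be ga be' ga'
  assume fx: "f be = be" "f ga = ga" "f be' = be'" "f ga' = ga'"
    and eq: "be + ga * c = be' + ga' * c"
  have "be + be' = (be + ga * c) + (be' + ga' * c) + c * (ga + ga')"
    by (simp add: algebra_simps)
  then have "be + be' = c * (ga + ga')" by (simp add: eq)
  from ff_eq_c_multiple[OF _ _ this] have "be + be' = 0" "ga + ga' = 0" using fx by simp_all
  then show "be = be' \<and> ga = ga'" by (simp add: add_eq_0_char2)
qed

end

section \<open>Counting\<close>

lemma power_card_eq_self:
  fixes x :: "'a::{field,finite}"
  shows "x ^ CARD('a) = x"
proof (cases "x = 0")
  case False
  have "(\<Prod>y\<in>UNIV - {0}. y) = (\<Prod>y\<in>UNIV - {0}. x * y)"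
    by (rule prod.reindex_bij_witness[of _ "\<lambda>y. x * y" "\<lambda>y. y / x"]) (use False in auto)
  also have "\<dots> = x ^ (CARD('a) - 1) * (\<Prod>y\<in>UNIV - {0}. y)"
    by (simp add: prod.distrib card_Diff_singleton)
  finally have "x ^ (CARD('a) - 1) = 1"
    by simp
  then show ?thesis
    by (simp add: power_eq_if)
qed simp

lemma add_power_two_power:
  fixes x y :: "'a::comm_ring_1"
  assumes "(2::'a) = 0"
  shows "(x + y) ^ 2 ^ n = x ^ 2 ^ n + y ^ 2 ^ n"
proof (induction n)
  case (Suc n)
  have "(x + y) ^ 2 ^ Suc n = (x ^ 2 ^ n + y ^ 2 ^ n)\<^sup>2"
    by (simp add: Suc power_mult mult.commute[of 2])
  also have "\<dots> = (x ^ 2 ^ n)\<^sup>2 + (y ^ 2 ^ n)\<^sup>2"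
    by (simp add: power2_sum assms)
  finally show ?case by (simp add: power_mult[symmetric] mult.commute)
qed simp

lemma card_frobenius_fixed:
  fixes q :: nat
  assumes card: "CARD('a::{field,finite}) = q ^ 4" and q: "q > 1" and two: "(2::'a) = 0"
    and add: "\<And>x y :: 'a. (x + y) ^ q = x ^ q + y ^ q"
  shows "card {x::'a. x ^ q = x} = q"
proof (rule antisym)
  define p :: "'a poly" where "p = monom 1 q + monom 1 1"
  have neg: "- x = x" for x :: 'a
    using two by (metis add_eq_0_iff mult_2 mult_zero_left)
  have self: "x + x = 0" for x :: 'a
    using neg[of x] by (metis add.right_inverse)
  have p: "poly p x = x ^ q + x" for x by (simp add: p_def poly_monom)
  have eq: "x ^ q + x = 0 \<longleftrightarrow> x ^ q = x" for x :: 'a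
    by (metis neg add_eq_0_iff)
  have "coeff p q = 1" using q by (simp add: p_def)
  then have "p \<noteq> 0" by auto
  then have "card {x. poly p x = 0} \<le> degree p" by (rule card_poly_roots_bound)
  also have "degree p \<le> q"
    unfolding p_def using q by (intro degree_add_le) (auto intro: order.trans[OF degree_monom_le])
  finally show "card {x::'a. x ^ q = x} \<le> q" by (simp add: p eq)
  \<comment> \<open>The map \<open>x \<mapsto> x ^ q + x\<close> has kernel \<open>{x. x ^ q = x}\<close>, and its image consists of
    zeros of the trace polynomial, of degree \<open>q ^ 3\<close>.\<close>
  define tr :: "'a poly" where "tr = monom 1 (q ^ 3) + monom 1 (q ^ 2) + monom 1 q + monom 1 1"
  have tr: "poly tr x = x ^ q ^ 3 + x ^ q ^ 2 + x ^ q + x" for x by (simp add: tr_def poly_monom)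
  have less: "q < q ^ 2" "q ^ 2 < q ^ 3" "1 < q ^ 3"
    using q power_strict_increasing[of 1 2 q] power_strict_increasing[of 2 3 q] one_less_power[of q 3]
    by simp_all
  have "coeff tr (q ^ 3) = 1" using less by (simp add: tr_def)
  then have "tr \<noteq> 0" by auto
  then have "card {x. poly tr x = 0} \<le> degree tr" by (rule card_poly_roots_bound)
  also have "degree tr \<le> q ^ 3"
    unfolding tr_def using less
    by (intro degree_add_le) (auto intro: order.trans[OF degree_monom_le])
  finally have tr_card: "card {x. poly tr x = 0} \<le> q ^ 3" .
  have pow: "(x ^ q ^ i) ^ q = x ^ q ^ Suc i" for x :: 'a and i
    by (simp add: power_mult[symmetric] mult.commute)
  have add_i: "(x + y) ^ q ^ i = x ^ q ^ i + y ^ q ^ i" for x y :: 'a and i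
  proof (induction i)
    case (Suc i)
    show ?case unfolding pow[symmetric] by (simp only: Suc add)
  qed simp
  have "poly tr (x ^ q + x) = 0" for x
  proof -
    have "x ^ q ^ 4 = x" using power_card_eq_self[of x] card by simp
    then have "(x ^ q) ^ q ^ 3 = x" "(x ^ q) ^ q ^ 2 = x ^ q ^ 3" "(x ^ q) ^ q = x ^ q ^ 2"
      by (simp_all add: power_mult[symmetric] eval_nat_numeral)
    then have "poly tr (x ^ q + x) = (x + x) + (x ^ q ^ 3 + x ^ q ^ 3) + (x ^ q ^ 2 + x ^ q ^ 2) + (x ^ q + x ^ q)"
      unfolding tr add_i add by (simp add: ac_simps)
    then show ?thesis by (simp only: self add_0)
  qed
  then have rhs: "card (range (\<lambda>x::'a. x ^ q + x)) \<le> q ^ 3"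
    using tr_card card_mono[of "{x. poly tr x = 0}" "range (\<lambda>x::'a. x ^ q + x)"] by force
  have fibre: "card {x. x ^ q + x = y ^ q + y} \<le> card {x::'a. x ^ q = x}" for y :: 'a
  proof (rule card_inj_on_le[of "\<lambda>x. x + y"])
    show "(\<lambda>x. x + y) ` {x. x ^ q + x = y ^ q + y} \<subseteq> {x. x ^ q = x}"
    proof clarify
      fix x :: 'a assume "x ^ q + x = y ^ q + y"
      then have "(x + y) ^ q + (x + y) = (y ^ q + y) + (y ^ q + y)" by (simp add: add ac_simps)
      then show "(x + y) ^ q = x + y" using self eq by metis
    qed
  qed (auto simp: inj_on_def)
  have "q ^ 4 = card (\<Union>z\<in>range (\<lambda>x::'a. x ^ q + x). {x. x ^ q + x = z})"
    by (subst card[symmetric]) (rule arg_cong[of _ _ card], auto)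
  also have "\<dots> \<le> (\<Sum>z\<in>range (\<lambda>x::'a. x ^ q + x). card {x. x ^ q + x = z})"
    by (rule card_UN_le) simp
  also have "\<dots> \<le> card (range (\<lambda>x::'a. x ^ q + x)) * card {x::'a. x ^ q = x}"
    using sum_bounded_above[of "range (\<lambda>x::'a. x ^ q + x)" "\<lambda>z. card {x. x ^ q + x = z}"
        "card {x::'a. x ^ q = x}"] fibre by auto
  also have "\<dots> \<le> q ^ 3 * card {x::'a. x ^ q = x}" using rhs by simp
  finally have "q ^ 3 * q \<le> q ^ 3 * card {x::'a. x ^ q = x}" by (simp add: eval_nat_numeral)
  then show "q \<le> card {x::'a. x ^ q = x}" using q by simp
qed

text \<open>The first equation counts values \<open>b\<close>, the second counts arguments
  \<open>x\<close> by their value.\<close>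

lemma card_fibres_012:
  fixes F :: "'a::finite \<Rightarrow> 'a"
  assumes "\<And>b. card {x. F x = b} \<in> {0, 1, 2}"
  shows "CARD('a) = card {b. card {x. F x = b} = 0} + card {b. card {x. F x = b} = 1}
      + card {b. card {x. F x = b} = 2}" (is "_ = card ?A0 + card ?A1 + card ?A2")
    and "CARD('a) = card {b. card {x. F x = b} = 1} + 2 * card {b. card {x. F x = b} = 2}"
proof -
  have U: "UNIV = (?A0 \<union> ?A1) \<union> ?A2" using assms by blast
  have "card (UNIV :: 'a set) = card (?A0 \<union> ?A1) + card ?A2"
    by (subst U, rule card_Un_disjoint) auto
  also have "card (?A0 \<union> ?A1) = card ?A0 + card ?A1"
    by (rule card_Un_disjoint) auto
  finally show "CARD('a) = card ?A0 + card ?A1 + card ?A2" .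
  have "card (\<Union>b\<in>UNIV. {x. F x = b}) = (\<Sum>b\<in>UNIV. card {x. F x = b})"
    by (rule card_UN_disjoint) auto
  moreover have "(\<Union>b\<in>UNIV. {x. F x = b}) = UNIV" by auto
  ultimately have "CARD('a) = (\<Sum>b\<in>UNIV. card {x. F x = b})" by simp
  also have "\<dots> = (\<Sum>b\<in>(?A0 \<union> ?A1) \<union> ?A2. card {x. F x = b})"
    by (subst U[symmetric]) simp
  also have "\<dots> = (\<Sum>b\<in>?A0. card {x. F x = b}) + (\<Sum>b\<in>?A1. card {x. F x = b}) + (\<Sum>b\<in>?A2. card {x. F x = b})"
    by (subst sum.union_disjoint, simp, simp, fastforce)+ simp
  also have "\<dots> = card ?A1 + 2 * card ?A2" by simp
  finally show "CARD('a) = card ?A1 + 2 * card ?A2" .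
qed

theorem theorem2:
  fixes n q :: nat and c :: "'a::{field,finite}"
  assumes "n \<ge> 1"
    and "q = 2 ^ n"
    and "CARD('a) = q ^ 4"
    and "c \<in> unity_roots (q^2 + 1) - {1}"
  shows "real (omega q c 0) = (real q ^ 4 - real q ^ 2) / 2
       \<and> real (omega q c 2) = (real q ^ 4 - real q ^ 2) / 2
       \<and> omega q c 1 = q ^ 2"
proof -
  have q: "even q" "q > 1" using one_less_power[of "2::nat" n] assms(1,2) by simp_all
  have q4: "x ^ q ^ 4 = x" for x :: 'a using power_card_eq_self[of x] assms(3) by simp
  \<comment> \<open>The power is 1 because \<open>q\<close> is even and -1 by \<open>q4\<close>, so
    the characteristic is two.\<close>
  have "(- 1) ^ q ^ 4 = (1::'a)" using q by simp
  then have "(- 1) = (1::'a)" using q4 by simp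
  then have two: "(2::'a) = 0" by (metis add.right_inverse one_add_one)
  have add_q: "(x + y) ^ q = x ^ q + y ^ q" for x y :: 'a
    using add_power_two_power[OF two] assms(2) by simp
  have c: "c \<noteq> 0" "c \<noteq> 1" "c ^ (q ^ 2 + 1) = 1" using assms(4) by (auto simp: unity_roots_def)
  have half: "q ^ 4 div 2 * 2 = q ^ 4" using q by simp
  interpret frobenius_char2 "\<lambda>x. x ^ q" "\<lambda>x. x ^ (q ^ 4 div 2)" c
  proof
    show "(((x ^ q) ^ q) ^ q) ^ q = x" for x :: 'a
      using q4[of x] by (simp add: power_mult[symmetric] eval_nat_numeral mult.assoc)
    show "x ^ (q ^ 4 div 2) * x ^ (q ^ 4 div 2) = x" for x :: 'a
      using q4[of x] half by (metis power2_eq_square power_mult)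
    have "(c ^ q) ^ q * c = 1" using c(3) by (simp add: power_mult[symmetric] power2_eq_square mult.commute)
    then show "(c ^ q) ^ q = inverse c" by (metis inverse_unique mult.commute)
  qed (use two c in \<open>simp_all add: add_q power_mult_distrib\<close>)
  let ?d = "(q - 1) * (q^2 + 1) + 2"
  have relnorm: "relnorm x = x ^ (q ^ 2 + 1)" for x :: 'a
    by (simp add: relnorm_def power_mult[symmetric] power2_eq_square)
  have pow_d: "x ^ ?d = (x * unit_part x)\<^sup>2" for x :: 'a
  proof (cases "x = 0")
    case False
    \<comment> \<open>Identifies \<open>relnorm x ^ (q - 1)\<close> with the square of
      \<open>unit_part x\<close>.\<close>
    have "relnorm x * relnorm x ^ (q - 1) = relnorm x ^ q"
      using q by (metis power_eq_if not_one_less_zero)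
    then have "relnorm x ^ (q - 1) = relnorm x ^ q / relnorm x" using False by (simp add: field_simps)
    also have "\<dots> = (unit_part x)\<^sup>2" by (simp add: unit_part_def rt_sq power2_eq_square)
    finally have "relnorm x ^ (q - 1) = (unit_part x)\<^sup>2" .
    moreover have "x ^ ?d = x\<^sup>2 * relnorm x ^ (q - 1)"
      unfolding relnorm power_mult[symmetric] by (simp only: power_add ac_simps)
    ultimately show ?thesis by (simp add: power_mult_distrib)
  qed simp
  have "(x + 1) ^ ?d + c^2 * x ^ ?d = (cdiff x)\<^sup>2" for x
    unfolding pow_d cdiff_def by (simp add: power2_eq_square sum_sq ac_simps)
  then have "(x + 1) ^ ?d + c^2 * x ^ ?d = b^2 \<longleftrightarrow> cdiff x = b" for x b
    by (metis power2_eq_square sq_inj)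
  then have omega: "omega q c i = card {b. card {x. cdiff x = b} = i}" for i
    by (simp only: omega_def)
  have all: "card {x. cdiff x = b} \<in> {0, 1, 2}" for b by (rule card_fibre_le_2)
  have one: "omega q c 1 = q ^ 2"
    unfolding omega card_fibre_eq_1 card_image[OF inj_on_c_combination] card_cartesian_product
    using card_frobenius_fixed[OF assms(3) q(2) two add_q] by (simp add: power2_eq_square)
  \<comment> \<open>With \<open>omega q c 1\<close> known, these two linear equations determine the
    other counts.\<close>
  have "q ^ 4 = omega q c 0 + omega q c 1 + omega q c 2" "q ^ 4 = omega q c 1 + 2 * omega q c 2"
    using card_fibres_012[of cdiff, OF all] assms(3) by (simp_all only: omega)
  then have "real (q ^ 4) = real (omega q c 0 + omega q c 1 + omega q c 2)"
    "real (q ^ 4) = real (omega q c 1 + 2 * omega q c 2)" by simp_all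
  then show ?thesis unfolding one by simp
qed

end
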